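(* Let $U\subset\mathbb{R}^N$ be a bounded set and let $0\le s\le N$. Then $$\frac{\mathcal{M}^s_*(U,\mathbb{R}^N)}{\gamma_{N-s}}\le\frac{\mathcal{M}^s_*(U,\mathbb{R}^{N+1})}{\gamma_{N+1-s}}\le\frac{\mathcal{M}^{*s}(U,\mathbb{R}^{N+1})}{\gamma_{N+1-s}}\le\frac{\mathcal{M}^{*s}(U,\mathbb{R}^{N})}{\gamma_{N-s}}.$$ These inequalities hold (in $[0,\infty]$) also when some of the Minkowski contents are equal to $0$ or $\infty$.
   Context: For a bounded set $U\subset\mathbb{R}^N$ and $\varepsilon>0$, let $U_\varepsilon^N=\{x\in\mathbb{R}^N: d_N(x,U)\le\varepsilon\}$, where $d_N$ is the Euclidean distance, and let $\mathrm{vol}_N$ be Lebesgue measure on $\mathbb{R}^N$. The lower and upper $s$-dimensional Minkowski contents of $U$ in $\mathbb{R}^N$ are $$\mathcal{M}^s_*(U,\mathbb{R}^N)=\liminf_{\varepsilon\to0}\frac{\mathrm{vol}_N(U_\varepsilon^N)}{\varepsilon^{N-s}},\qquad \mathcal{M}^{*s}(U,\mathbb{R}^N)=\limsup_{\varepsilon\to0}\frac{\mathrm{vol}_N(U_\varepsilon^N)}{\varepsilon^{N-s}},$$ with values in $[0,\infty]$. The contents $\mathcal{M}^s_*(U,\mathbb{R}^{N+1})$ and $\mathcal{M}^{*s}(U,\mathbb{R}^{N+1})$ are those of $U$ regarded as the subset $U\times\{0\}$ of $\mathbb{R}^{N+1}$, defined by the same formulas with $N+1$ in place of $N$ (so the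 normalizing power is $\varepsilon^{N+1-s}$). For real $t\ge0$, $\gamma_t=\dfrac{\pi^{t/2}}{\Gamma(t/2+1)}$, where $\Gamma$ is the gamma function. *)

theory Defs
  imports "HOL-Analysis.Analysis"
begin

text \<open>The distance to the empty set is infinite, whereas \<^term>\<open>infdist x {} = 0\<close>;
  hence the nonemptiness condition, which makes the parallel sets of the empty set empty.\<close>

definition parallel_set :: "real \<Rightarrow> 'a::euclidean_space set \<Rightarrow> 'a set" where
  "parallel_set \<epsilon> U = {x. U \<noteq> {} \<and> infdist x U \<le> \<epsilon>}"

text \<open>The ambient space is determined by the type of \<open>U\<close>; its dimension is \<open>DIM('a)\<close>.\<close>

definition lower_minkowski_content :: "real \<Rightarrow> 'a::euclidean_space set \<Rightarrow> ennreal" where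
  "lower_minkowski_content s U =
     Liminf (at_right 0)
       (\<lambda>\<epsilon>. emeasure lebesgue (parallel_set \<epsilon> U) / ennreal (\<epsilon> powr (real DIM('a) - s)))"

definition upper_minkowski_content :: "real \<Rightarrow> 'a::euclidean_space set \<Rightarrow> ennreal" where
  "upper_minkowski_content s U =
     Limsup (at_right 0)
       (\<lambda>\<epsilon>. emeasure lebesgue (parallel_set \<epsilon> U) / ennreal (\<epsilon> powr (real DIM('a) - s)))"

text \<open>For real \<open>t \<ge> 0\<close>, the library's \<^term>\<open>unit_ball_vol t\<close> is
  \<open>\<gamma>\<^sub>t = pi powr (t / 2) / Gamma (t / 2 + 1)\<close>. The space of dimension \<open>N + 1\<close> is represented
  by the product of \<^typ>\<open>real ^ 'n\<close> and \<^typ>\<open>real\<close>, whose norm is the Euclidean one.\<close>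

end

theory Submission
  imports Defs
begin

text \<open>
  Write \<open>V(r)\<close> for the volume of the \<open>r\<close>-parallel set of \<open>U\<close> and put \<open>t = N - s\<close>. By Pythagoras, a
  point \<open>(x, y)\<close> lies within \<open>\<epsilon>\<close> of \<open>U \<times> {0}\<close> exactly if \<open>\<bar>y\<bar> \<le> \<epsilon>\<close> and \<open>x\<close> lies within the half-chord
  length \<open>sqrt (\<epsilon>\<^sup>2 - y\<^sup>2)\<close> of \<open>U\<close>. Slicing the parallel set in the higher dimension along the last
  coordinate therefore gives
  \<open>V'(\<epsilon>) = \<integral> V(sqrt (\<epsilon>\<^sup>2 - y\<^sup>2)) dy\<close>, the integral ranging over \<open>-\<epsilon> < y < \<epsilon>\<close>
  (\<open>emeasure_parallel_set_Times_zero\<close>).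

  All radii occurring in this integral are at most \<open>\<epsilon>\<close>. Hence a bound \<open>c * r powr t \<le> V(r)\<close> that holds
  for all small \<open>r\<close> can be integrated, and the model integral
  \<open>\<integral> (\<epsilon>\<^sup>2 - y\<^sup>2) powr (t / 2) dy = \<epsilon> powr (t + 1) * Beta (1 / 2) (t / 2 + 1)\<close>
  (\<open>nn_integral_chord_powr\<close>) turns it into the bound \<open>c * Beta (1 / 2) (t / 2 + 1) * \<epsilon> powr (t + 1) \<le> V'(\<epsilon>)\<close>;
  the same works for upper bounds. Letting \<open>c\<close> tend to the lower (upper) content of \<open>U\<close>, passing to
  \<open>U \<times> {0}\<close> multiplies the lower content by at least, and the upper content by at most, the Beta
  value (\<open>lower_minkowski_content_Times_zero\<close>, \<open>upper_minkowski_content_Times_zero\<close>).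
  This Beta value is exactly the quotient of \<open>unit_ball_vol (t + 1)\<close> by \<open>unit_ball_vol t\<close>
  (\<open>unit_ball_vol_plus_one\<close>), so the normalised contents compare as claimed. The constants \<open>c\<close> range
  over the extended nonnegative reals, which covers the contents \<open>0\<close> and \<open>\<infinity>\<close> without case distinctions.
\<close>

section \<open>Slices of parallel sets\<close>

text \<open>Pythagoras for the product metric. The infimum need not be attained, so the upper bound is
  obtained from nearly closest points and a limit.\<close>

lemma infdist_Times_singleton:
  fixes U :: "'a::metric_space set" and c :: "'b::metric_space"
  assumes "U \<noteq> {}"
  shows "infdist (x, y) (U \<times> {c}) = sqrt ((infdist x U)\<^sup>2 + (dist y c)\<^sup>2)"
proof (rule antisym)
  show "sqrt ((infdist x U)\<^sup>2 + (dist y c)\<^sup>2) \<le> infdist (x, y) (U \<times> {c})"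
    using assms unfolding infdist_notempty[of "U \<times> {c}", simplified, OF assms]
    by (intro cINF_greatest)
       (auto simp: dist_Pair_Pair infdist_nonneg infdist_le intro!: real_sqrt_le_mono power_mono)
  have "(infdist (x, y) (U \<times> {c}) \<le> sqrt ((infdist x U + e)\<^sup>2 + (dist y c)\<^sup>2))" if "e > 0" for e
  proof -
    obtain a where a: "a \<in> U" "dist x a < infdist x U + e"
      using \<open>e > 0\<close> assms cINF_less_iff[of U "dist x" "infdist x U + e"]
      by (auto simp: infdist_notempty)
    have "infdist (x, y) (U \<times> {c}) \<le> dist (x, y) (a, c)"
      using a by (intro infdist_le) auto
    also have "\<dots> \<le> sqrt ((infdist x U + e)\<^sup>2 + (dist y c)\<^sup>2)"
      using a by (auto simp: dist_Pair_Pair intro!: real_sqrt_le_mono power_mono)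
    finally show ?thesis .
  qed
  moreover have "((\<lambda>e. sqrt ((infdist x U + e)\<^sup>2 + (dist y c)\<^sup>2)) \<longlongrightarrow>
      sqrt ((infdist x U + 0)\<^sup>2 + (dist y c)\<^sup>2)) (at_right 0)"
    by (intro tendsto_intros)
  ultimately show "infdist (x, y) (U \<times> {c}) \<le> sqrt ((infdist x U)\<^sup>2 + (dist y c)\<^sup>2)"
    by (intro tendsto_lowerbound[of _ _ "at_right 0"])
       (auto intro: eventually_at_right_less[THEN eventually_mono])
qed

lemma closed_parallel_set: "closed (parallel_set \<epsilon> U)"
proof (cases "U = {}")
  case False
  then show ?thesis
    by (auto simp: parallel_set_def intro!: closed_Collect_le continuous_intros)
qed (auto simp: parallel_set_def)

lemma parallel_set_slice:
  fixes U :: "'a::euclidean_space set"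
  assumes "\<epsilon> \<ge> 0"
  shows "(\<lambda>x. (x, y)) -` parallel_set \<epsilon> (U \<times> {0::real}) =
           (if \<bar>y\<bar> \<le> \<epsilon> then parallel_set (sqrt (\<epsilon>\<^sup>2 - y\<^sup>2)) U else {})"
proof (cases "U = {}")
  case False
  have "sqrt ((infdist x U)\<^sup>2 + y\<^sup>2) \<le> \<epsilon> \<longleftrightarrow> \<bar>y\<bar> \<le> \<epsilon> \<and> infdist x U \<le> sqrt (\<epsilon>\<^sup>2 - y\<^sup>2)" for x
  proof -
    have "sqrt ((infdist x U)\<^sup>2 + y\<^sup>2) \<le> \<epsilon> \<longleftrightarrow> (infdist x U)\<^sup>2 + y\<^sup>2 \<le> \<epsilon>\<^sup>2"
      using assms by (intro real_sqrt_le_iff') auto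
    also have "\<dots> \<longleftrightarrow> \<bar>y\<bar> \<le> \<epsilon> \<and> (infdist x U)\<^sup>2 \<le> \<epsilon>\<^sup>2 - y\<^sup>2"
      using assms abs_le_square_iff[of y \<epsilon>] by (auto simp: algebra_simps) (smt (verit) zero_le_power2)
    also have "\<dots> \<longleftrightarrow> \<bar>y\<bar> \<le> \<epsilon> \<and> infdist x U \<le> sqrt (\<epsilon>\<^sup>2 - y\<^sup>2)"
      using infdist_nonneg[of x U] real_sqrt_le_iff[of "(infdist x U)\<^sup>2" "\<epsilon>\<^sup>2 - y\<^sup>2"] by simp
    finally show ?thesis .
  qed
  with False show ?thesis
    by (auto simp: parallel_set_def infdist_Times_singleton dist_real_def)
qed (simp add: parallel_set_def)

lemma nn_integral_lborel_cong_countable: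
  fixes f g :: "'a::euclidean_space \<Rightarrow> ennreal"
  assumes "countable N" and "\<And>y. y \<notin> N \<Longrightarrow> f y = g y"
  shows "(\<integral>\<^sup>+ y. f y \<partial>lborel) = (\<integral>\<^sup>+ y. g y \<partial>lborel)"
  using AE_not_in[OF countable_imp_null_set_lborel[OF assms(1)]] assms(2)
  by (intro nn_integral_cong_AE) (auto elim: eventually_mono)

text \<open>Fubini along the last coordinate. The two end slices \<open>y = \<epsilon>\<close> and \<open>y = -\<epsilon>\<close>, which are copies of
  the closure of \<open>U\<close>, are left out of the integral so that only strictly positive radii occur: the
  bounds on \<open>V(r)\<close> to be inserted later hold for \<open>r > 0\<close> only.\<close>

lemma emeasure_parallel_set_Times_zero:
  fixes U :: "'a::euclidean_space set"
  assumes "\<epsilon> \<ge> 0"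
  shows "emeasure lebesgue (parallel_set \<epsilon> (U \<times> {0::real})) =
    (\<integral>\<^sup>+ y. emeasure lebesgue (parallel_set (sqrt (\<epsilon>\<^sup>2 - y\<^sup>2)) U) * indicator {-\<epsilon><..<\<epsilon>} y \<partial>lborel)"
proof -
  have lborel: "emeasure lebesgue (parallel_set e V) = emeasure lborel (parallel_set e V)"
    for e and V :: "'c::euclidean_space set"
    by (simp add: closed_parallel_set borel_closed)
  have "emeasure lborel (parallel_set \<epsilon> (U \<times> {0::real})) =
      (\<integral>\<^sup>+ y. emeasure lborel ((\<lambda>x. (x, y)) -` parallel_set \<epsilon> (U \<times> {0::real})) \<partial>lborel)"
    unfolding lborel_prod[symmetric]
    by (intro lborel_pair.emeasure_pair_measure_alt2)
       (subst lborel_prod, simp add: closed_parallel_set borel_closed)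
  also have "\<dots> = (\<integral>\<^sup>+ y. emeasure lborel (parallel_set (sqrt (\<epsilon>\<^sup>2 - y\<^sup>2)) U) *
      indicator {-\<epsilon><..<\<epsilon>} y \<partial>lborel)"
    using assms
    by (intro nn_integral_lborel_cong_countable[of "{-\<epsilon>, \<epsilon>}"])
       (auto simp: parallel_set_slice split: split_indicator)
  finally show ?thesis by (simp only: lborel)
qed

section \<open>The chord integral and volumes of unit balls\<close>

lemma Beta_real_pos:
  fixes a b :: real
  assumes "a > 0" and "b > 0"
  shows "Beta a b > 0"
  unfolding Beta_def using assms by (intro divide_pos_pos mult_pos_pos Gamma_real_pos) simp_all

text \<open>The substitution \<open>u = (y / \<epsilon>)\<^sup>2\<close> transforms Euler's Beta integral into this one. It is injective only
  on half of the chord; the factor \<open>2\<close> accounts for the other half.\<close>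

lemma nn_integral_half_chord_powr:
  fixes \<epsilon> t :: real
  assumes "\<epsilon> > 0" and "t > -2"
  shows "(\<integral>\<^sup>+ y. ennreal (2 * sqrt (\<epsilon>\<^sup>2 - y\<^sup>2) powr t) * indicator {0..\<epsilon>} y \<partial>lborel) =
           ennreal (\<epsilon> powr (t + 1) * Beta (1 / 2) (t / 2 + 1))"
proof -
  let ?f = "\<lambda>u::real. u powr (-1 / 2) * (1 - u) powr (t / 2)"
  have "(?f has_integral Beta (1 / 2) (t / 2 + 1)) {0..1}"
    using has_integral_Beta_real[of "1/2" "t / 2 + 1"] assms by simp
  from nn_integral_has_integral_lebesgue[OF _ this]
  have "ennreal (Beta (1 / 2) (t / 2 + 1)) = (\<integral>\<^sup>+ u. ennreal (?f u * indicator {(0/\<epsilon>)\<^sup>2..(\<epsilon>/\<epsilon>)\<^sup>2} u) \<partial>lborel)"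
    using assms by (simp add: mult_ac ennreal_mult' ennreal_indicator)
  also have "\<dots> = (\<integral>\<^sup>+ y. ennreal (?f ((y / \<epsilon>)\<^sup>2) * (2 * y / \<epsilon>\<^sup>2) * indicator {0..\<epsilon>} y) \<partial>lborel)"
    using assms
    by (subst nn_integral_substitution[where g = "\<lambda>y. (y / \<epsilon>)\<^sup>2" and g' = "\<lambda>y. 2 * y / \<epsilon>\<^sup>2"])
       (auto intro!: derivative_eq_intros continuous_intros
         simp: set_borel_measurable_def power2_eq_square)
  finally have "ennreal (\<epsilon> powr (t + 1) * Beta (1 / 2) (t / 2 + 1)) =
      ennreal (\<epsilon> powr (t + 1)) *
      (\<integral>\<^sup>+ y. ennreal (?f ((y / \<epsilon>)\<^sup>2) * (2 * y / \<epsilon>\<^sup>2) * indicator {0..\<epsilon>} y) \<partial>lborel)"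
    by (simp add: ennreal_mult')
  also have "\<dots> = (\<integral>\<^sup>+ y. ennreal (\<epsilon> powr (t + 1)) *
      ennreal (?f ((y / \<epsilon>)\<^sup>2) * (2 * y / \<epsilon>\<^sup>2) * indicator {0..\<epsilon>} y) \<partial>lborel)"
    by (subst nn_integral_cmult) auto
  also have "\<dots> = (\<integral>\<^sup>+ y. ennreal (2 * sqrt (\<epsilon>\<^sup>2 - y\<^sup>2) powr t) * indicator {0..\<epsilon>} y \<partial>lborel)"
  proof (rule nn_integral_lborel_cong_countable)
    show "countable {0, \<epsilon>}" by simp
  next
    fix y :: real assume "y \<notin> {0, \<epsilon>}"
    show "ennreal (\<epsilon> powr (t + 1)) * ennreal (?f ((y / \<epsilon>)\<^sup>2) * (2 * y / \<epsilon>\<^sup>2) * indicator {0..\<epsilon>} y) =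
        ennreal (2 * sqrt (\<epsilon>\<^sup>2 - y\<^sup>2) powr t) * indicator {0..\<epsilon>} y"
    proof (cases "y \<in> {0..\<epsilon>}")
      case True
      with \<open>y \<notin> {0, \<epsilon>}\<close> have y: "0 < y" "y < \<epsilon>" by auto
      have "y\<^sup>2 < \<epsilon>\<^sup>2" using y by (intro power_strict_mono) auto
      have "(1 - (y / \<epsilon>)\<^sup>2) powr (t / 2) = ((\<epsilon>\<^sup>2 - y\<^sup>2) / \<epsilon>\<^sup>2) powr (t / 2)"
        using assms by (simp add: power_divide diff_divide_distrib)
      also have "\<dots> = sqrt (\<epsilon>\<^sup>2 - y\<^sup>2) powr t / \<epsilon> powr t"
        using assms \<open>y\<^sup>2 < \<epsilon>\<^sup>2\<close> powr_powr[of \<epsilon> 2 "t / 2"]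
        by (simp add: powr_divide powr_half_sqrt[symmetric] powr_powr)
      (* For u = (y / \<epsilon>)\<^sup>2 the factor u powr (-1/2) is \<epsilon> / y, which turns the Jacobian 2 y / \<epsilon>\<^sup>2 into 2 / \<epsilon>;
         the remaining powers of \<epsilon> cancel against \<epsilon> powr (t + 1). *)
      finally have "?f ((y / \<epsilon>)\<^sup>2) = \<epsilon> / y * (sqrt (\<epsilon>\<^sup>2 - y\<^sup>2) powr t / \<epsilon> powr t)"
        using y assms by (simp add: powr_minus powr_half_sqrt inverse_eq_divide)
      then have "\<epsilon> powr (t + 1) * (?f ((y / \<epsilon>)\<^sup>2) * (2 * y / \<epsilon>\<^sup>2)) = 2 * sqrt (\<epsilon>\<^sup>2 - y\<^sup>2) powr t"
        using y assms by (simp add: powr_add power2_eq_square)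
      with True show ?thesis by (simp add: ennreal_mult'[symmetric])
    qed simp
  qed
  finally show ?thesis ..
qed

lemma nn_integral_chord_powr:
  fixes \<epsilon> t :: real
  assumes "\<epsilon> > 0" and "t > -2"
  shows "(\<integral>\<^sup>+ y. ennreal (sqrt (\<epsilon>\<^sup>2 - y\<^sup>2) powr t) * indicator {-\<epsilon><..<\<epsilon>} y \<partial>lborel) =
           ennreal (\<epsilon> powr (t + 1) * Beta (1 / 2) (t / 2 + 1))"
proof -
  let ?h = "\<lambda>y. ennreal (sqrt (\<epsilon>\<^sup>2 - y\<^sup>2) powr t)"
  have "(\<integral>\<^sup>+ y. ?h y * indicator {-\<epsilon><..<\<epsilon>} y \<partial>lborel) =
      (\<integral>\<^sup>+ y. ?h y * indicator {-\<epsilon>..0} y + ?h y * indicator {0..\<epsilon>} y \<partial>lborel)"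
    by (intro nn_integral_lborel_cong_countable[of "{-\<epsilon>, 0, \<epsilon>}"])
       (use assms in \<open>auto split: split_indicator\<close>)
  also have "\<dots> = (\<integral>\<^sup>+ y. ?h y * indicator {-\<epsilon>..0} y \<partial>lborel) + (\<integral>\<^sup>+ y. ?h y * indicator {0..\<epsilon>} y \<partial>lborel)"
    by (intro nn_integral_add) auto
  also have "(\<integral>\<^sup>+ y. ?h y * indicator {-\<epsilon>..0} y \<partial>lborel) = (\<integral>\<^sup>+ y. ?h y * indicator {0..\<epsilon>} y \<partial>lborel)"
    by (subst nn_integral_real_affine[of _ "-1" 0])
       (auto intro!: nn_integral_cong split: split_indicator)
  also have "\<dots> + \<dots> = (\<integral>\<^sup>+ y. ennreal (2 * sqrt (\<epsilon>\<^sup>2 - y\<^sup>2) powr t) * indicator {0..\<epsilon>} y \<partial>lborel)"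
    by (subst nn_integral_add[symmetric])
       (simp_all add: ennreal_mult' mult_2[symmetric] mult.assoc)
  finally show ?thesis
    using nn_integral_half_chord_powr[OF assms] by simp
qed

text \<open>The recursion behind the volume of Euclidean balls, for arbitrary real dimension: since
  \<open>Gamma (1 / 2) = sqrt pi\<close>, the Gamma factors cancel.\<close>

lemma unit_ball_vol_plus_one:
  assumes "t \<ge> 0"
  shows "unit_ball_vol (t + 1) = unit_ball_vol t * Beta (1 / 2) (t / 2 + 1)"
proof -
  have pos: "Gamma (t / 2 + 1) > 0"
    using assms by (intro Gamma_real_pos) simp
  have half: "pi powr ((t + 1) / 2) = pi powr (t / 2) * sqrt pi"
    by (simp add: add_divide_distrib powr_add powr_half_sqrt)
  have shift: "(t + 1) / 2 + 1 = 1 / 2 + (t / 2 + 1)"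
    by (simp add: field_simps)
  show ?thesis
    using pos unfolding unit_ball_vol_def Beta_def half shift Gamma_one_half_real by simp
qed

section \<open>Comparison of the contents\<close>

lemma chord_bounds:
  fixes \<epsilon> y :: real
  assumes "y \<in> {-\<epsilon><..<\<epsilon>}"
  shows "0 < sqrt (\<epsilon>\<^sup>2 - y\<^sup>2)" and "sqrt (\<epsilon>\<^sup>2 - y\<^sup>2) \<le> \<epsilon>"
proof -
  have "y\<^sup>2 < \<epsilon>\<^sup>2"
    using assms by (intro power2_strict_mono) auto
  then show "0 < sqrt (\<epsilon>\<^sup>2 - y\<^sup>2)" by simp
  show "sqrt (\<epsilon>\<^sup>2 - y\<^sup>2) \<le> \<epsilon>"
    using assms by (intro real_le_lsqrt) auto
qed

text \<open>The slicing integral is monotone in the volumes of the slices, and for volumes given by a power of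
  the radius it is the chord integral. This lemma and the next are the two resulting estimates.\<close>

lemma emeasure_parallel_set_Times_zero_ge:
  fixes U :: "'a::euclidean_space set" and c :: ennreal
  assumes "\<epsilon> > 0" and "t > -2"
    and le: "\<And>r. 0 < r \<Longrightarrow> r \<le> \<epsilon> \<Longrightarrow> c * ennreal (r powr t) \<le> emeasure lebesgue (parallel_set r U)"
  shows "c * ennreal (\<epsilon> powr (t + 1) * Beta (1 / 2) (t / 2 + 1)) \<le>
           emeasure lebesgue (parallel_set \<epsilon> (U \<times> {0::real}))"
proof -
  have "c * ennreal (\<epsilon> powr (t + 1) * Beta (1 / 2) (t / 2 + 1)) =
      (\<integral>\<^sup>+ y. c * (ennreal (sqrt (\<epsilon>\<^sup>2 - y\<^sup>2) powr t) * indicator {-\<epsilon><..<\<epsilon>} y) \<partial>lborel)"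
    using assms by (simp add: nn_integral_cmult nn_integral_chord_powr)
  also have "\<dots> \<le> (\<integral>\<^sup>+ y. emeasure lebesgue (parallel_set (sqrt (\<epsilon>\<^sup>2 - y\<^sup>2)) U) *
      indicator {-\<epsilon><..<\<epsilon>} y \<partial>lborel)"
    using le[OF chord_bounds] by (intro nn_integral_mono) (auto split: split_indicator)
  finally show ?thesis
    using assms by (simp add: emeasure_parallel_set_Times_zero)
qed

lemma emeasure_parallel_set_Times_zero_le:
  fixes U :: "'a::euclidean_space set" and c :: ennreal
  assumes "\<epsilon> > 0" and "t > -2"
    and le: "\<And>r. 0 < r \<Longrightarrow> r \<le> \<epsilon> \<Longrightarrow> emeasure lebesgue (parallel_set r U) \<le> c * ennreal (r powr t)"
  shows "emeasure lebesgue (parallel_set \<epsilon> (U \<times> {0::real})) \<le>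
           c * ennreal (\<epsilon> powr (t + 1) * Beta (1 / 2) (t / 2 + 1))"
proof -
  have "emeasure lebesgue (parallel_set \<epsilon> (U \<times> {0::real})) =
      (\<integral>\<^sup>+ y. emeasure lebesgue (parallel_set (sqrt (\<epsilon>\<^sup>2 - y\<^sup>2)) U) * indicator {-\<epsilon><..<\<epsilon>} y \<partial>lborel)"
    using assms by (simp add: emeasure_parallel_set_Times_zero)
  also have "\<dots> \<le> (\<integral>\<^sup>+ y. c * (ennreal (sqrt (\<epsilon>\<^sup>2 - y\<^sup>2) powr t) * indicator {-\<epsilon><..<\<epsilon>} y) \<partial>lborel)"
    using le[OF chord_bounds] by (intro nn_integral_mono) (auto split: split_indicator)
  also have "\<dots> = c * ennreal (\<epsilon> powr (t + 1) * Beta (1 / 2) (t / 2 + 1))"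
    using assms by (simp add: nn_integral_cmult nn_integral_chord_powr)
  finally show ?thesis .
qed

lemma ennreal_le_divide_iff:
  fixes a c :: ennreal
  assumes "b > 0"
  shows "c \<le> a / ennreal b \<longleftrightarrow> c * ennreal b \<le> a"
  using assms divide_less_ennreal[of "ennreal b" a c] by (simp add: not_less[symmetric])

lemma ennreal_divide_le_iff:
  fixes a c :: ennreal
  assumes "b > 0"
  shows "a / ennreal b \<le> c \<longleftrightarrow> a \<le> c * ennreal b"
proof
  assume "a / ennreal b \<le> c"
  then have "a / ennreal b * ennreal b \<le> c * ennreal b"
    by (rule mult_right_mono) simp
  with assms show "a \<le> c * ennreal b"
    by (simp add: ennreal_divide_times)
qed (use assms in \<open>auto intro: divide_le_posI_ennreal simp: mult.commute\<close>)

text \<open>The slicing integral at \<open>\<epsilon>\<close> involves all radii up to \<open>\<epsilon>\<close>, so a bound on the volumes is needed on a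
  whole initial segment.\<close>

lemma eventually_at_right_0_initial_segment:
  fixes P :: "real \<Rightarrow> bool"
  assumes "\<forall>\<^sub>F r in at_right 0. P r"
  shows "\<forall>\<^sub>F \<epsilon> in at_right 0. \<epsilon> > 0 \<and> (\<forall>r. 0 < r \<and> r \<le> \<epsilon> \<longrightarrow> P r)"
proof -
  obtain b where b: "b > 0" "\<forall>r>0. r < b \<longrightarrow> P r"
    using assms unfolding eventually_at_right_field by (elim exE conjE)
  have "\<forall>\<^sub>F \<epsilon> in at_right 0. \<epsilon> \<in> {0<..<b}"
    using \<open>b > 0\<close> by (rule eventually_at_right_real)
  then show ?thesis
    by (rule eventually_mono) (use b(2) in \<open>simp add: order.strict_trans1\<close>)
qed

text \<open>The volumes satisfy the bound \<open>c * r powr t \<le> V(r)\<close> on a whole interval of radii for each \<open>c\<close> strictly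
  below the lower content, but not necessarily for the content itself; density of the extended
  nonnegative reals closes this gap. The hypothesis on \<open>s\<close> amounts to \<open>t > -2\<close>, the condition for the chord
  integral to converge.\<close>

lemma lower_minkowski_content_Times_zero:
  fixes U :: "'a::euclidean_space set"
  assumes "s < real DIM('a) + 2"
  shows "lower_minkowski_content s U * ennreal (Beta (1 / 2) ((real DIM('a) - s) / 2 + 1)) \<le>
           lower_minkowski_content s (U \<times> {0::real})"
proof -
  define t where "t = real DIM('a) - s"
  define B where "B = Beta (1 / 2) (t / 2 + 1)"
  have t: "t > -2"
    using assms by (simp add: t_def)
  then have B: "B > 0"
    unfolding B_def by (intro Beta_real_pos) simp_all
  have dim: "real DIM('a \<times> real) - s = t + 1" by (simp add: t_def)
  have "lower_minkowski_content s U \<le> lower_minkowski_content s (U \<times> {0::real}) / ennreal B"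
  proof (rule dense_le)
    fix c assume "c < lower_minkowski_content s U"
    then have "\<forall>\<^sub>F r in at_right 0. c < emeasure lebesgue (parallel_set r U) / ennreal (r powr t)"
      unfolding lower_minkowski_content_def t_def by (rule less_LiminfD)
    then have "\<forall>\<^sub>F \<epsilon> in at_right 0. c * ennreal B \<le>
        emeasure lebesgue (parallel_set \<epsilon> (U \<times> {0::real})) / ennreal (\<epsilon> powr (t + 1))"
    proof (rule eventually_at_right_0_initial_segment[THEN eventually_mono], elim conjE)
      fix \<epsilon> :: real
      assume "\<epsilon> > 0" and *: "\<forall>r. 0 < r \<and> r \<le> \<epsilon> \<longrightarrow>
        c < emeasure lebesgue (parallel_set r U) / ennreal (r powr t)"
      have "c * ennreal (\<epsilon> powr (t + 1) * B) \<le> emeasure lebesgue (parallel_set \<epsilon> (U \<times> {0::real}))"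
        unfolding B_def using \<open>\<epsilon> > 0\<close> t *
        by (intro emeasure_parallel_set_Times_zero_ge)
           (simp_all add: ennreal_le_divide_iff[symmetric] less_imp_le)
      with \<open>\<epsilon> > 0\<close> B show "c * ennreal B \<le>
          emeasure lebesgue (parallel_set \<epsilon> (U \<times> {0::real})) / ennreal (\<epsilon> powr (t + 1))"
        by (simp add: ennreal_le_divide_iff ennreal_mult mult_ac)
    qed
    then have "c * ennreal B \<le> lower_minkowski_content s (U \<times> {0::real})"
      unfolding lower_minkowski_content_def dim by (rule Liminf_bounded)
    with B show "c \<le> lower_minkowski_content s (U \<times> {0::real}) / ennreal B"
      by (simp add: ennreal_le_divide_iff)
  qed
  with B show ?thesis
    by (simp add: ennreal_le_divide_iff B_def t_def)
qed

lemma upper_minkowski_content_Times_zero: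
  fixes U :: "'a::euclidean_space set"
  assumes "s < real DIM('a) + 2"
  shows "upper_minkowski_content s (U \<times> {0::real}) \<le>
           upper_minkowski_content s U * ennreal (Beta (1 / 2) ((real DIM('a) - s) / 2 + 1))"
proof -
  define t where "t = real DIM('a) - s"
  define B where "B = Beta (1 / 2) (t / 2 + 1)"
  have t: "t > -2"
    using assms by (simp add: t_def)
  then have B: "B > 0"
    unfolding B_def by (intro Beta_real_pos) simp_all
  have dim: "real DIM('a \<times> real) - s = t + 1" by (simp add: t_def)
  have "upper_minkowski_content s (U \<times> {0::real}) / ennreal B \<le> upper_minkowski_content s U"
  proof (rule dense_ge)
    fix c assume "upper_minkowski_content s U < c"
    then have "\<forall>\<^sub>F r in at_right 0. emeasure lebesgue (parallel_set r U) / ennreal (r powr t) < c"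
      unfolding upper_minkowski_content_def t_def by (rule Limsup_lessD)
    then have "\<forall>\<^sub>F \<epsilon> in at_right 0.
        emeasure lebesgue (parallel_set \<epsilon> (U \<times> {0::real})) / ennreal (\<epsilon> powr (t + 1)) \<le> c * ennreal B"
    proof (rule eventually_at_right_0_initial_segment[THEN eventually_mono], elim conjE)
      fix \<epsilon> :: real
      assume "\<epsilon> > 0" and *: "\<forall>r. 0 < r \<and> r \<le> \<epsilon> \<longrightarrow>
        emeasure lebesgue (parallel_set r U) / ennreal (r powr t) < c"
      have "emeasure lebesgue (parallel_set \<epsilon> (U \<times> {0::real})) \<le> c * ennreal (\<epsilon> powr (t + 1) * B)"
        unfolding B_def using \<open>\<epsilon> > 0\<close> t *
        by (intro emeasure_parallel_set_Times_zero_le)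
           (simp_all add: ennreal_divide_le_iff[symmetric] less_imp_le)
      with \<open>\<epsilon> > 0\<close> B show "emeasure lebesgue (parallel_set \<epsilon> (U \<times> {0::real})) /
          ennreal (\<epsilon> powr (t + 1)) \<le> c * ennreal B"
        by (simp add: ennreal_divide_le_iff ennreal_mult mult_ac)
    qed
    then have "upper_minkowski_content s (U \<times> {0::real}) \<le> c * ennreal B"
      unfolding upper_minkowski_content_def dim by (rule Limsup_bounded)
    with B show "upper_minkowski_content s (U \<times> {0::real}) / ennreal B \<le> c"
      by (simp add: ennreal_divide_le_iff)
  qed
  with B show ?thesis
    by (simp add: ennreal_divide_le_iff B_def t_def)
qed

theorem theorem5:
  fixes U :: "(real ^ 'n) set" and s :: real
  assumes "bounded U"
    and "0 \<le> s" and "s \<le> real CARD('n)"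
  shows "lower_minkowski_content s U / ennreal (unit_ball_vol (real CARD('n) - s))
           \<le> lower_minkowski_content s (U \<times> {0::real}) / ennreal (unit_ball_vol (real CARD('n) + 1 - s))
       \<and> lower_minkowski_content s (U \<times> {0::real}) / ennreal (unit_ball_vol (real CARD('n) + 1 - s))
           \<le> upper_minkowski_content s (U \<times> {0::real}) / ennreal (unit_ball_vol (real CARD('n) + 1 - s))
       \<and> upper_minkowski_content s (U \<times> {0::real}) / ennreal (unit_ball_vol (real CARD('n) + 1 - s))
           \<le> upper_minkowski_content s U / ennreal (unit_ball_vol (real CARD('n) - s))"
proof -
  define t where "t = real CARD('n) - s"
  define B where "B = Beta (1 / 2) (t / 2 + 1)"
  define \<gamma> where "\<gamma> = unit_ball_vol t"
  have "t \<ge> 0" using assms by (simp add: t_def)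
  have \<gamma>: "\<gamma> > 0" and \<gamma>': "unit_ball_vol (real CARD('n) + 1 - s) = \<gamma> * B"
    using \<open>t \<ge> 0\<close> unit_ball_vol_plus_one[of t] by (simp_all add: \<gamma>_def B_def t_def algebra_simps)
  have B: "B > 0"
    using \<gamma> \<gamma>' \<open>t \<ge> 0\<close> unit_ball_vol_pos[of "t + 1"] by (simp add: t_def algebra_simps zero_less_mult_iff)
  (* Expanding by B, which is neither 0 nor \<infinity>, is valid for every x, including \<infinity>. *)
  have cancel: "x / ennreal \<gamma> = x * ennreal B / ennreal (\<gamma> * B)" for x
    using \<gamma> B by (simp add: ennreal_mult divide_mult_eq)
  have "lower_minkowski_content s U * ennreal B \<le> lower_minkowski_content s (U \<times> {0::real})"
    and "upper_minkowski_content s (U \<times> {0::real}) \<le> upper_minkowski_content s U * ennreal B"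
    using lower_minkowski_content_Times_zero[of s U] upper_minkowski_content_Times_zero[of s U] assms
    by (simp_all add: B_def t_def)
  moreover have "lower_minkowski_content s (U \<times> {0::real}) \<le> upper_minkowski_content s (U \<times> {0::real})"
    unfolding lower_minkowski_content_def upper_minkowski_content_def by (intro Liminf_le_Limsup) simp
  ultimately show ?thesis
    unfolding \<gamma>' t_def[symmetric] \<gamma>_def[symmetric] cancel
    by (intro conjI divide_right_mono_ennreal)
qed

end
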